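(* For every fixed integer $t\ge 1$, $$\operatorname{ex}(n,W_t)=\Theta_t\bigl(\operatorname{ex}(n,C_8)\bigr),$$ where the implied constants depend only on $t$. More precisely, for every $n$, $$\operatorname{ex}(n,C_8)\le \operatorname{ex}(n,W_t)\le 2^{14(t-1)+2}\operatorname{ex}(n,C_8)+7(t-1)n .$$
   Context: All graphs are finite and simple. The extremal number $\operatorname{ex}(n,H)$ is the maximum number of edges in an $n$-vertex graph containing no (not necessarily induced) subgraph isomorphic to $H$. $C_8$ is the cycle with $8$ vertices. For an integer $t\ge 1$, $W_t$ is the graph obtained by taking $t$ vertex-disjoint copies of $C_8$ and identifying one vertex from each cycle into a single common vertex, so that any two of the $t$ cycles intersect exactly in this common vertex. *)

theory Defs
  imports Complex_Main "HOL-Library.Landau_Symbols"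
begin

record 'a ugraph =
  verts :: "'a set"
  edges :: "'a set set"

definition simple_graph :: "'a ugraph \<Rightarrow> bool" where
  "simple_graph G \<longleftrightarrow>
     finite (verts G) \<and> (\<forall>e\<in>edges G. e \<subseteq> verts G \<and> card e = 2)"

definition subgraph :: "'a ugraph \<Rightarrow> 'a ugraph \<Rightarrow> bool" where
  "subgraph K G \<longleftrightarrow> simple_graph K \<and> verts K \<subseteq> verts G \<and> edges K \<subseteq> edges G"

definition isomorphic :: "'a ugraph \<Rightarrow> 'b ugraph \<Rightarrow> bool" where
  "isomorphic G H \<longleftrightarrow>
     (\<exists>f. bij_betw f (verts G) (verts H) \<and> edges H = (\<lambda>e. f ` e) ` edges G)"

definition contains_copy :: "'a ugraph \<Rightarrow> 'b ugraph \<Rightarrow> bool" where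
  "contains_copy G H \<longleftrightarrow> (\<exists>K. subgraph K G \<and> isomorphic K H)"

text \<open>Every finite graph is isomorphic to one whose vertices are natural numbers, so it suffices
  to range over graphs with vertex type \<^typ>\<open>nat\<close>. The maximum below is over a finite set, and
  over a nonempty one as soon as \<open>H\<close> has an edge.\<close>

definition ex_number :: "nat \<Rightarrow> 'b ugraph \<Rightarrow> nat" where
  "ex_number n H =
     Max {card (edges G) | G :: nat ugraph.
            simple_graph G \<and> card (verts G) = n \<and> \<not> contains_copy G H}"

text \<open>A simple graph only for \<open>k \<ge> 3\<close>.\<close>

definition cycle_graph :: "nat \<Rightarrow> nat ugraph" where
  "cycle_graph k =
     \<lparr>verts = {..<k}, edges = {{i, Suc i mod k} | i. i < k}\<rparr>"

definition disjoint_copies :: "nat \<Rightarrow> 'a ugraph \<Rightarrow> (nat \<times> 'a) ugraph" where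
  "disjoint_copies t G =
     \<lparr>verts = {..<t} \<times> verts G, edges = {Pair i ` e | i e. i < t \<and> e \<in> edges G}\<rparr>"

text \<open>\<open>glue\<close> identifies the vertices \<open>(i, 0)\<close> of all the copies with the single vertex
  \<open>(0, 0)\<close> and leaves all other vertices unchanged.\<close>

definition glue :: "nat \<times> nat \<Rightarrow> nat \<times> nat" where
  "glue p = (if snd p = 0 then (0, 0) else p)"

definition W_graph :: "nat \<Rightarrow> (nat \<times> nat) ugraph" where
  "W_graph t =
     (let D = disjoint_copies t (cycle_graph 8)
      in \<lparr>verts = glue ` verts D, edges = (\<lambda>e. glue ` e) ` edges D\<rparr>)"

lemma finite_ex_number_set:
  "finite {card (edges G) | G :: nat ugraph.
             simple_graph G \<and> card (verts G) = n \<and> \<not> contains_copy G H}"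
proof (rule finite_subset)
  show "{card (edges G) | G :: nat ugraph.
           simple_graph G \<and> card (verts G) = n \<and> \<not> contains_copy G H} \<subseteq> {..2 ^ n}"
  proof clarsimp
    fix G :: "nat ugraph"
    assume G: "simple_graph G"
    then have "edges G \<subseteq> Pow (verts G)" "finite (verts G)"
      by (auto simp: simple_graph_def)
    then show "card (edges G) \<le> 2 ^ card (verts G)"
      by (metis card_Pow card_mono finite_Pow_iff)
  qed
qed simp

lemma ex_number_set_nonempty:
  assumes "edges H \<noteq> {}"
  shows "{card (edges G) | G :: nat ugraph.
            simple_graph G \<and> card (verts G) = n \<and> \<not> contains_copy G H} \<noteq> {}"
proof -
  let ?G = "\<lparr>verts = {..<n}, edges = {}\<rparr>"
  have "simple_graph ?G" "card (verts ?G) = n" by (simp_all add: simple_graph_def)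
  moreover have "\<not> contains_copy ?G H"
    using assms by (auto simp: contains_copy_def subgraph_def isomorphic_def)
  ultimately show ?thesis by blast
qed

end

(* At each vertex v of a W_t-free graph, a maximal family of 8-cycles through v pairwise meeting only
   in v has fewer than t members, so their other vertices form a set S(v) of size at most
   s = 7(t-1) which meets every 8-cycle through v.  Discard the at most s n edges joining some v to
   S(v).  For a uniformly random vertex set B let U be the set of v in B with S(v) disjoint from B.
   A cycle inside U would meet S(v) for its own vertex v, so G[U] contains no 8-cycle; on the other
   hand each remaining edge survives in U with probability at least 2^-(2s+2). *)
theory Submission
  imports Defs
begin

section \<open>Copies as injective maps, and bounds on extremal numbers\<close>

text \<open>An isomorphism from a copy onto \<open>H\<close> is inverted on the vertices of the
  copy; the inverse cancels on edges because these lie inside the vertex set. Conversely the image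
  of \<open>H\<close> is the copy, and injectivity keeps its edges two-element sets.\<close>

lemma contains_copy_iff_embedding:
  assumes H: "simple_graph H"
  shows "contains_copy G H \<longleftrightarrow>
    (\<exists>f. inj_on f (verts H) \<and> f ` verts H \<subseteq> verts G \<and> (\<forall>e\<in>edges H. f ` e \<in> edges G))"
    (is "_ \<longleftrightarrow> ?R")
proof
  assume "contains_copy G H"
  then obtain K f where K: "subgraph K G" and f: "bij_betw f (verts K) (verts H)"
    "edges H = (\<lambda>e. f ` e) ` edges K"
    by (auto simp: contains_copy_def isomorphic_def)
  let ?g = "inv_into (verts K) f"
  have g: "bij_betw ?g (verts H) (verts K)"
    using f(1) by (rule bij_betw_inv_into)
  have "?g ` e \<in> edges G" if "e \<in> edges H" for e
  proof -
    have "e \<in> (\<lambda>e. f ` e) ` edges K"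
      using that by (simp only: f(2))
    then obtain d where d: "e = f ` d" "d \<in> edges K"
      by (rule imageE)
    have "d \<subseteq> verts K"
      using K d(2) by (auto simp: subgraph_def simple_graph_def)
    then have "?g ` e = d"
      using f(1) d(1) by (simp add: bij_betw_def inv_into_image_cancel)
    then show ?thesis
      using K d(2) by (auto simp: subgraph_def)
  qed
  moreover have "inj_on ?g (verts H)" "?g ` verts H \<subseteq> verts G"
    using g K by (auto simp: bij_betw_def subgraph_def)
  ultimately show ?R by blast
next
  assume ?R
  then obtain f where f: "inj_on f (verts H)" "f ` verts H \<subseteq> verts G"
    "\<And>e. e \<in> edges H \<Longrightarrow> f ` e \<in> edges G"
    by blast
  let ?K = "\<lparr>verts = f ` verts H, edges = (\<lambda>e. f ` e) ` edges H\<rparr>"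
  let ?g = "inv_into (verts H) f"
  have sub: "e \<subseteq> verts H" "card e = 2" if "e \<in> edges H" for e
    using H that by (auto simp: simple_graph_def)
  have "f ` e \<subseteq> f ` verts H \<and> card (f ` e) = 2" if "e \<in> edges H" for e
    using sub[OF that] f(1) by (simp add: image_mono card_image inj_on_subset)
  then have "subgraph ?K G"
    using H f by (simp add: subgraph_def simple_graph_def image_subset_iff)
  moreover have "isomorphic ?K H"
    unfolding isomorphic_def
  proof (intro exI conjI)
    show "bij_betw ?g (verts ?K) (verts H)"
      using bij_betw_inv_into[OF inj_on_imp_bij_betw[OF f(1)]] by simp
    have "?g ` f ` e = e" if "e \<in> edges H" for e
      using f(1) sub(1)[OF that] by (simp add: inv_into_image_cancel)
    then show "edges H = (\<lambda>e. ?g ` e) ` edges ?K"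
      by (auto simp: image_image)
  qed
  ultimately show "contains_copy G H"
    by (auto simp: contains_copy_def)
qed

lemma card_edges_le_ex_number:
  fixes G :: "nat ugraph"
  assumes "simple_graph G" "card (verts G) = n" "\<not> contains_copy G H"
  shows "card (edges G) \<le> ex_number n H"
  unfolding ex_number_def using assms by (intro Max_ge finite_ex_number_set) blast

text \<open>An edge of \<open>H\<close> makes the edgeless graph \<open>H\<close>-free, so the
  maximum is taken over a nonempty set. For an edgeless \<open>H\<close> that set can be empty and
  \<open>Max\<close> is then unspecified.\<close>

lemma ex_number_le:
  assumes "edges H \<noteq> {}"
    and "\<And>G :: nat ugraph. simple_graph G \<Longrightarrow> card (verts G) = n \<Longrightarrow> \<not> contains_copy G H \<Longrightarrow>
      card (edges G) \<le> m"
  shows "ex_number n H \<le> m"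
  unfolding ex_number_def
  using assms(2)
  by (intro Max.boundedI finite_ex_number_set ex_number_set_nonempty[OF assms(1)]) auto

section \<open>Embeddings of the 8-cycle and the structure of W_t\<close>

text \<open>Labelling the cycle by positions singles out \<open>f 0\<close>, so that a cycle through
  \<open>v\<close> can be expressed as \<open>f 0 = v\<close>.\<close>

definition cycle_embedding :: "'a ugraph \<Rightarrow> (nat \<Rightarrow> 'a) \<Rightarrow> bool" where
  "cycle_embedding G f \<longleftrightarrow> inj_on f {..<8} \<and> f ` {..<8} \<subseteq> verts G \<and>
     (\<forall>i<8. {f i, f (Suc i mod 8)} \<in> edges G)"

lemma cycle_graph_edge_card:
  assumes "k \<ge> 3" "i < k"
  shows "card {i, Suc i mod k} = 2"
proof -
  have "i \<noteq> Suc i mod k"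
    using assms by (cases "Suc i = k") auto
  then show ?thesis by simp
qed

lemma simple_cycle_graph: "k \<ge> 3 \<Longrightarrow> simple_graph (cycle_graph k)"
  using cycle_graph_edge_card by (auto simp: simple_graph_def cycle_graph_def)

lemma contains_cycle_iff: "contains_copy G (cycle_graph 8) \<longleftrightarrow> (\<exists>f. cycle_embedding G f)"
proof -
  have E: "edges (cycle_graph 8) = (\<lambda>i. {i, Suc i mod 8}) ` {..<8}"
    by (auto simp: cycle_graph_def)
  have V: "verts (cycle_graph 8) = {..<8}"
    by (simp add: cycle_graph_def)
  show ?thesis
    by (simp add: contains_copy_iff_embedding simple_cycle_graph cycle_embedding_def E V)
      (simp add: Ball_def)
qed

lemma verts_W_graph: "verts (W_graph t) = glue ` ({..<t} \<times> {..<8})"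
  by (simp add: W_graph_def disjoint_copies_def cycle_graph_def)

lemma edges_W_graph:
  "edges (W_graph t) = {{glue (i, j), glue (i, Suc j mod 8)} | i j. i < t \<and> j < 8}"
proof -
  have "edges (W_graph t) =
      (\<lambda>e. glue ` e) ` {Pair i ` e | i e. i < t \<and> e \<in> {{j, Suc j mod 8} | j. j < 8}}"
    by (simp add: W_graph_def disjoint_copies_def cycle_graph_def Let_def)
  also have "{Pair i ` e | i e. i < t \<and> e \<in> {{j, Suc j mod 8} | j. j < 8}} =
      {{(i, j), (i, Suc j mod 8)} | i j. i < t \<and> j < 8}"
    by (auto; metis image_empty image_insert)
  also have "(\<lambda>e. glue ` e) ` \<dots> = {{glue (i, j), glue (i, Suc j mod 8)} | i j. i < t \<and> j < 8}"
    by (auto simp: image_iff) (metis image_empty image_insert)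
  finally show ?thesis .
qed

text \<open>Gluing merges vertices of different copies only, so each copy survives as a genuine
  8-cycle.\<close>

lemma inj_glue_copy: "inj (\<lambda>j. glue (i, j))"
  by (auto simp: inj_def glue_def)

lemma simple_W_graph: "simple_graph (W_graph t)"
proof -
  have "card {glue (i, j), glue (i, Suc j mod 8)} = 2" if "j < 8" for i j
    using card_image[OF inj_on_subset[OF inj_glue_copy], of "{j, Suc j mod 8}" i]
      cycle_graph_edge_card[of 8 j] that by simp
  then show ?thesis
    unfolding simple_graph_def verts_W_graph edges_W_graph by auto
qed

lemma contains_cycle_if_contains_W_graph:
  assumes "contains_copy G (W_graph t)" "t \<ge> 1"
  shows "contains_copy G (cycle_graph 8)"
proof -
  obtain f where f: "inj_on f (verts (W_graph t))" "f ` verts (W_graph t) \<subseteq> verts G"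
    "\<forall>e\<in>edges (W_graph t). f ` e \<in> edges G"
    using assms(1) by (auto simp: contains_copy_iff_embedding simple_W_graph)
  let ?h = "\<lambda>j. f (glue (0, j))"
  have V: "glue (0, j) \<in> verts (W_graph t)" if "j < 8" for j
    using that assms(2) by (auto simp: verts_W_graph)
  have E: "{glue (0, j), glue (0, Suc j mod 8)} \<in> edges (W_graph t)" if "j < 8" for j
    using that assms(2) unfolding edges_W_graph by (intro CollectI exI[of _ 0] exI[of _ j]) auto
  have "inj_on ?h {..<8}"
    using f(1) V inj_glue_copy[of 0] unfolding inj_on_def by blast
  moreover have "?h ` {..<8} \<subseteq> verts G"
    using f(2) V by blast
  moreover have "{?h j, ?h (Suc j mod 8)} \<in> edges G" if "j < 8" for j
    using bspec[OF f(3) E[OF that]] by simp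
  ultimately have "cycle_embedding G ?h"
    by (simp add: cycle_embedding_def)
  then show ?thesis
    by (auto simp: contains_cycle_iff)
qed

section \<open>Bouquets of 8-cycles and hitting sets\<close>

definition cycle_bouquet :: "'a ugraph \<Rightarrow> 'a \<Rightarrow> nat \<Rightarrow> (nat \<Rightarrow> nat \<Rightarrow> 'a) \<Rightarrow> bool" where
  "cycle_bouquet G v k c \<longleftrightarrow> (\<forall>i<k. cycle_embedding G (c i) \<and> c i 0 = v) \<and>
     (\<forall>i<k. \<forall>j<k. i \<noteq> j \<longrightarrow> c i ` {1..<8} \<inter> c j ` {1..<8} = {})"

lemma contains_W_graph_if_bouquet:
  assumes c: "cycle_bouquet G v k c" and "t \<le> k"
  shows "contains_copy G (W_graph t)"
proof -
  let ?g = "\<lambda>p. c (fst p) (snd p)"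
  have c1: "cycle_embedding G (c i)" "c i 0 = v" if "i < t" for i
    using c that assms(2) by (auto simp: cycle_bouquet_def)
  have c2: "c i a \<noteq> c j b" if "i < t" "j < t" "i \<noteq> j" "a \<in> {1..<8}" "b \<in> {1..<8}" for i j a b
  proof -
    have "i < k" "j < k" using that assms(2) by auto
    then have "c i ` {1..<8} \<inter> c j ` {1..<8} = {}"
      using c that(3) unfolding cycle_bouquet_def by blast
    then show ?thesis using that(4,5) by blast
  qed
  \<comment> \<open>The glued centre \<open>(0, 0)\<close> is sent to \<open>c 0 0\<close>, which is
    \<open>v\<close> and hence equals every \<open>c i 0\<close>; this makes \<open>?g\<close>
    compatible with the gluing.\<close>
  have g: "?g (glue (i, j)) = c i j" if "i < t" for i j
    using c1(2)[of i] c1(2)[of 0] that by (auto simp: glue_def)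
  have z: "c i a = v \<longleftrightarrow> a = 0" if "i < t" "a < 8" for i a
    using c1[OF that(1)] that(2) by (auto simp: cycle_embedding_def inj_on_def)
  have inj: "glue (i, a) = glue (j, b)"
    if "i < t" "j < t" "a < 8" "b < 8" and eq: "c i a = c j b" for i j a b
  \<comment> \<open>If one point is the centre, the common value is \<open>v\<close>, so both are.
    Otherwise disjointness of the petals forces \<open>i = j\<close>, and injectivity of
    \<open>c i\<close> gives \<open>a = b\<close>.\<close>
  proof (cases "a = 0 \<or> b = 0")
    case True
    then have "a = 0 \<and> b = 0"
      using z[OF that(1,3)] z[OF that(2,4)] eq by auto
    then show ?thesis by (simp add: glue_def)
  next
    case False
    then have "i = j"
      using c2[of i j a b] that by auto
    moreover from this have "a = b"
      using c1(1)[OF that(1)] that by (auto simp: cycle_embedding_def inj_on_def)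
    ultimately show ?thesis by simp
  qed
  have "inj_on ?g (verts (W_graph t))"
    unfolding verts_W_graph
  proof (rule inj_onI, elim imageE SigmaE, goal_cases)
    case (1 x y p q i a j b)
    then show ?case using inj[of i j a b] g[of i a] g[of j b] by simp
  qed
  moreover have "?g ` verts (W_graph t) \<subseteq> verts G"
  proof
    fix x assume "x \<in> ?g ` verts (W_graph t)"
    then obtain i j where "i < t" "j < 8" "x = ?g (glue (i, j))"
      unfolding verts_W_graph by blast
    then show "x \<in> verts G"
      using g[of i j] c1(1)[of i] by (auto simp: cycle_embedding_def)
  qed
  moreover have "?g ` e \<in> edges G" if "e \<in> edges (W_graph t)" for e
    using that g c1(1) by (auto simp: edges_W_graph cycle_embedding_def)
  ultimately show ?thesis
    by (auto simp: contains_copy_iff_embedding simple_W_graph)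
qed

text \<open>Take a bouquet at \<open>v\<close> with the largest number of cycles and let S be its
  noncentral vertices: a cycle through \<open>v\<close> missing S could be added to it. Each cycle
  contributes at most 7 vertices, and W_t-freeness allows at most \<open>t - 1\<close>
  cycles.\<close>

lemma cycle_hitting_set:
  assumes free: "\<not> contains_copy G (W_graph t)"
  shows "\<exists>S. S \<subseteq> verts G - {v} \<and> card S \<le> 7 * (t - 1) \<and>
    (\<forall>f. cycle_embedding G f \<longrightarrow> f 0 = v \<longrightarrow> f ` {1..<8} \<inter> S \<noteq> {})"
proof -
  let ?P = "\<lambda>k. \<exists>c. cycle_bouquet G v k c"
  have "?P 0" by (simp add: cycle_bouquet_def)
  moreover have "\<And>k. ?P k \<Longrightarrow> k \<le> t"
    using contains_W_graph_if_bouquet[where t = t] free by (meson nat_le_linear)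
  ultimately obtain k where k: "?P k" and kmax: "\<And>m. ?P m \<Longrightarrow> m \<le> k"
    using Nat.ex_has_greatest_nat[of ?P 0 t] by blast
  then obtain c where c: "cycle_bouquet G v k c" by blast
  have "k < t"
    using c free contains_W_graph_if_bouquet by (metis not_le)
  let ?S = "\<Union>i<k. c i ` {1..<8}"
  have "?S \<subseteq> verts G - {v}"
    using c by (fastforce simp: cycle_bouquet_def cycle_embedding_def inj_on_def)
  moreover have "card ?S \<le> 7 * (t - 1)"
  proof -
    have "card ?S \<le> (\<Sum>i<k. card (c i ` {1..<8}))"
      by (simp add: card_UN_le)
    also have "\<dots> \<le> (\<Sum>i<k. 7)"
      using card_image_le[of "{1..<8::nat}"] by (intro sum_mono) simp
    also have "\<dots> \<le> 7 * (t - 1)"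
      using \<open>k < t\<close> by simp
    finally show ?thesis .
  qed
  moreover have "f ` {1..<8} \<inter> ?S \<noteq> {}" if "cycle_embedding G f" "f 0 = v" for f
  proof
    assume disj: "f ` {1..<8} \<inter> ?S = {}"
    then have "f ` {1..<8} \<inter> c i ` {1..<8} = {}" if "i < k" for i
      using that by blast
    \<comment> \<open>The indices in use are those below \<open>k\<close>, so index \<open>k\<close>
      is free for the new cycle.\<close>
    then have "cycle_bouquet G v (Suc k) (c(k := f))"
      using c that by (auto simp: cycle_bouquet_def less_Suc_eq)
    then show False
      using kmax by (metis Suc_n_not_le_n)
  qed
  ultimately show ?thesis by blast
qed

section \<open>The sampling argument\<close>

text \<open>Cleared of denominators, this says that a uniformly random subset of \<open>V\<close>
  contains \<open>A\<close> and avoids \<open>T\<close> with probability at least 2^-(a+b). The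
  favourable sets include all unions of \<open>A\<close> with a subset of
  \<open>V - A - T\<close>.\<close>

lemma card_Pow_separating:
  assumes "finite V" "A \<subseteq> V" "T \<subseteq> V" "A \<inter> T = {}" "card A \<le> a" "card T \<le> b"
  shows "2 ^ card V \<le> 2 ^ (a + b) * card {B \<in> Pow V. A \<subseteq> B \<and> T \<inter> B = {}}"
proof -
  let ?F = "{B \<in> Pow V. A \<subseteq> B \<and> T \<inter> B = {}}"
  have "(\<lambda>B. A \<union> B) ` Pow (V - A - T) \<subseteq> ?F"
    using assms(2,4) by blast
  moreover have "inj_on (\<lambda>B. A \<union> B) (Pow (V - A - T))"
    by (auto simp: inj_on_def)
  moreover have "finite ?F" using assms(1) by simp
  ultimately have "card (Pow (V - A - T)) \<le> card ?F"
    by (metis (no_types, lifting) card_image card_mono)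
  then have "2 ^ card (V - A - T) \<le> card ?F"
    using assms(1) by (simp add: card_Pow)
  moreover have "card V \<le> a + b + card (V - A - T)"
  proof -
    have "A \<union> T \<union> (V - A - T) = V"
      using assms(2,3) by blast
    then have "card V \<le> card A + card T + card (V - A - T)"
      by (metis add_le_mono1 card_Un_le order_trans)
    then show ?thesis
      using assms(5,6) by linarith
  qed
  ultimately show ?thesis
    by (metis (no_types, lifting) mult_le_mono2 one_le_numeral order_trans power_add power_increasing)
qed

text \<open>The random choice is carried out by counting pairs of an edge and a set \<open>B\<close>
  in which it survives: each edge outside \<open>D\<close> has many such \<open>B\<close>, while
  each \<open>B\<close> has at most \<open>m\<close> such edges by \<open>indep\<close>. Cycles
  enter only later, through \<open>indep\<close>.\<close>

lemma card_edges_le_sparse_conflicts: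
  fixes V :: "'a set" and S :: "'a \<Rightarrow> 'a set"
  assumes V: "finite V" and E: "\<And>e. e \<in> E \<Longrightarrow> e \<subseteq> V \<and> card e = 2"
    and S: "\<And>v. v \<in> V \<Longrightarrow> S v \<subseteq> V - {v}" "\<And>v. v \<in> V \<Longrightarrow> card (S v) \<le> s"
    and indep: "\<And>U. U \<subseteq> V \<Longrightarrow> (\<And>v. v \<in> U \<Longrightarrow> S v \<inter> U = {}) \<Longrightarrow> card {e \<in> E. e \<subseteq> U} \<le> m"
  shows "card E \<le> 2 ^ (2 * s + 2) * m + s * card V"
proof -
  \<comment> \<open>All conflicting pairs, whether or not they are edges; each vertex contributes at
    most \<open>s\<close> of them.\<close>
  define D where "D = (\<Union>v\<in>V. (\<lambda>w. {v, w}) ` S v)"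
  define U where "U B = {v \<in> B. S v \<inter> B = {}}" for B
  have finE: "finite E"
    using E V by (intro finite_subset[of E "Pow V"]) auto
  have finS: "finite (S v)" if "v \<in> V" for v
    using S(1)[OF that] V by (auto intro: finite_subset)
  have D: "card D \<le> s * card V" and finD: "finite D"
  proof -
    have "card D \<le> (\<Sum>v\<in>V. card ((\<lambda>w. {v, w}) ` S v))"
      unfolding D_def by (rule card_UN_le[OF V])
    also have "\<dots> \<le> (\<Sum>v\<in>V. s)"
      using S(2) by (intro sum_mono order_trans[OF card_image_le[OF finS]])
    finally show "card D \<le> s * card V" by (simp add: mult.commute)
    show "finite D" unfolding D_def using V finS by blast
  qed
  have survive: "2 ^ card V \<le> 2 ^ (2 * s + 2) * card {B \<in> Pow V. e \<subseteq> U B}" if e: "e \<in> E - D" for e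
  proof -
    obtain u w where uw: "e = {u, w}" "u \<in> V" "w \<in> V" "u \<noteq> w"
      using E[of e] e by (auto simp: card_2_iff)
    \<comment> \<open>Together with \<open>v\<close> not lying in \<open>S v\<close>, this makes the
      events "B contains e" and "B avoids both conflict sets" compatible.\<close>
    have "w \<notin> S u" "u \<notin> S w"
      using e uw by (auto simp: D_def insert_commute)
    then have disj: "e \<inter> (S u \<union> S w) = {}"
      using S(1) uw by auto
    have "card (S u \<union> S w) \<le> 2 * s"
      using S(2)[OF uw(2)] S(2)[OF uw(3)] card_Un_le[of "S u" "S w"] by linarith
    \<comment> \<open>The exponent counts prescribed memberships: 2 for the endpoints in
      \<open>B\<close>, at most \<open>2 * s\<close> for the conflict vertices outside
      \<open>B\<close>.\<close>
    then have "2 ^ card V \<le> 2 ^ (2 + 2 * s) * card {B \<in> Pow V. e \<subseteq> B \<and> (S u \<union> S w) \<inter> B = {}}"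
      using E[of e] e disj S(1) uw(2,3) by (intro card_Pow_separating[OF V]) auto
    also have "{B \<in> Pow V. e \<subseteq> B \<and> (S u \<union> S w) \<inter> B = {}} = {B \<in> Pow V. e \<subseteq> U B}"
      using uw(1) by (auto simp: U_def)
    finally show ?thesis by (simp add: add.commute)
  qed
  have "2 ^ card V * card (E - D) = (\<Sum>e\<in>E - D. 2 ^ card V)"
    by simp
  also have "\<dots> \<le> (\<Sum>e\<in>E - D. 2 ^ (2 * s + 2) * card {B \<in> Pow V. e \<subseteq> U B})"
    using survive by (rule sum_mono)
  also have "\<dots> = 2 ^ (2 * s + 2) * (\<Sum>e\<in>E - D. card {B \<in> Pow V. e \<subseteq> U B})"
    by (simp only: sum_distrib_left)
  \<comment> \<open>Double counting of the pairs \<open>(e, B)\<close> with \<open>e\<close> inside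
    \<open>U B\<close>.\<close>
  also have "(\<Sum>e\<in>E - D. card {B \<in> Pow V. e \<subseteq> U B}) = (\<Sum>B\<in>Pow V. card {e \<in> E - D. e \<subseteq> U B})"
    using finE V sum.swap_restrict[of "E - D" "Pow V" "\<lambda>_ _. 1::nat" "\<lambda>e B. e \<subseteq> U B"]
    by simp
  also have "\<dots> \<le> (\<Sum>B\<in>Pow V. m)"
  proof (rule sum_mono)
    fix B assume "B \<in> Pow V"
    then have "card {e \<in> E. e \<subseteq> U B} \<le> m"
      by (intro indep) (auto simp: U_def)
    moreover have "card {e \<in> E - D. e \<subseteq> U B} \<le> card {e \<in> E. e \<subseteq> U B}"
      using finE by (intro card_mono) auto
    ultimately show "card {e \<in> E - D. e \<subseteq> U B} \<le> m" by linarith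
  qed
  also have "\<dots> = 2 ^ card V * m"
    using V by (simp add: card_Pow)
  finally have "2 ^ card V * card (E - D) \<le> 2 ^ card V * (2 ^ (2 * s + 2) * m)"
    by (simp add: ac_simps)
  then have "card (E - D) \<le> 2 ^ (2 * s + 2) * m"
    by (simp only: mult_le_cancel1) simp
  moreover have "card E \<le> card (E - D) + card D"
    using finE finD by (metis card_Un_le card_mono finite_Diff finite_UnI Un_Diff_cancel2 Un_upper1 order_trans)
  ultimately show ?thesis using D by linarith
qed

section \<open>The upper bound and the order of magnitude\<close>

text \<open>The sampling bound is applied with \<open>s = 7 * (t - 1)\<close> and \<open>m\<close>
  the extremal number of C_8; the exponent \<open>2 * s + 2\<close> becomes
  \<open>14 * (t - 1) + 2\<close>.\<close>

lemma card_edges_W_graph_free: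
  assumes G: "simple_graph (G :: nat ugraph)" and free: "\<not> contains_copy G (W_graph t)"
  shows "card (edges G) \<le>
    2 ^ (14 * (t - 1) + 2) * ex_number (card (verts G)) (cycle_graph 8) + 7 * (t - 1) * card (verts G)"
proof -
  obtain S where S: "\<And>v. S v \<subseteq> verts G - {v}" "\<And>v. card (S v) \<le> 7 * (t - 1)"
    and hit: "\<And>f. cycle_embedding G f \<Longrightarrow> f ` {1..<8} \<inter> S (f 0) \<noteq> {}"
    using cycle_hitting_set[OF free] by metis
  have "card {e \<in> edges G. e \<subseteq> U} \<le> ex_number (card (verts G)) (cycle_graph 8)"
    if U: "U \<subseteq> verts G" "\<And>v. v \<in> U \<Longrightarrow> S v \<inter> U = {}" for U
  proof -
    \<comment> \<open>Keeping the vertices outside \<open>U\<close> as isolated ones leaves the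
      order unchanged, so no monotonicity of the extremal number in n is required.\<close>
    let ?H = "\<lparr>verts = verts G, edges = {e \<in> edges G. e \<subseteq> U}\<rparr>"
    have "\<not> cycle_embedding ?H f" for f
    proof
      assume f: "cycle_embedding ?H f"
      then have "f i \<in> U" if "i < 8" for i
        using that by (auto simp: cycle_embedding_def)
      moreover have "f ` {1..<8} \<inter> S (f 0) \<noteq> {}"
        using f by (intro hit) (auto simp: cycle_embedding_def)
      ultimately show False
        using U(2)[of "f 0"] by fastforce
    qed
    then have "card (edges ?H) \<le> ex_number (card (verts G)) (cycle_graph 8)"
      using G by (intro card_edges_le_ex_number) (auto simp: contains_cycle_iff simple_graph_def)
    then show ?thesis by simp
  qed
  then have "card (edges G) \<le> 2 ^ (2 * (7 * (t - 1)) + 2) * ex_number (card (verts G)) (cycle_graph 8)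
      + 7 * (t - 1) * card (verts G)"
    using G S by (intro card_edges_le_sparse_conflicts[where S = S]) (auto simp: simple_graph_def)
  then show ?thesis by (simp add: mult.assoc[symmetric])
qed

text \<open>A star contains no two disjoint edges, whereas an 8-cycle does. The bound lets the term
  linear in n be absorbed into the extremal number of C_8.\<close>

lemma star_edges_le_ex_number_cycle: "n - 1 \<le> ex_number n (cycle_graph 8)"
proof (cases "n = 0")
  case False
  let ?G = "\<lparr>verts = {..<n}, edges = (\<lambda>i. {0, i}) ` {1..<n}\<rparr>"
  have "\<not> cycle_embedding ?G f" for f
  proof
    assume f: "cycle_embedding ?G f"
    have "0 \<in> {f i, f (Suc i mod 8)}" if "i < 8" for i
    proof -
      have "{f i, f (Suc i mod 8)} \<in> edges ?G"
        using f that unfolding cycle_embedding_def by blast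
      then obtain x where "{f i, f (Suc i mod 8)} = {0, x}" by auto
      then show ?thesis by blast
    qed
    \<comment> \<open>Two disjoint edges of the cycle would both contain the centre 0 of the
      star.\<close>
    from this[of 0] this[of 2] have "0 \<in> {f 0, f 1}" "0 \<in> {f 2, f 3}"
      by simp_all
    moreover have inj: "inj_on f {..<8}"
      using f by (simp add: cycle_embedding_def)
    moreover have "f 0 \<noteq> f 2" "f 0 \<noteq> f 3" "f 1 \<noteq> f 2" "f 1 \<noteq> f 3"
      by (simp_all add: inj_on_eq_iff[OF inj])
    ultimately show False
      by (metis insertE singletonD)
  qed
  then have "card (edges ?G) \<le> ex_number n (cycle_graph 8)"
    using False
    by (intro card_edges_le_ex_number) (auto simp: contains_cycle_iff simple_graph_def card_insert_if)
  moreover have "card (edges ?G) = n - 1"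
    by (simp add: card_image inj_on_def doubleton_eq_iff)
  ultimately show ?thesis by simp
qed simp

theorem propositionA1:
  fixes t :: nat
  assumes "t \<ge> 1"
  shows "(\<lambda>n. real (ex_number n (W_graph t))) \<in> \<Theta>(\<lambda>n. real (ex_number n (cycle_graph 8)))
    \<and> (\<forall>n. ex_number n (cycle_graph 8) \<le> ex_number n (W_graph t)
         \<and> ex_number n (W_graph t)
             \<le> 2 ^ (14 * (t - 1) + 2) * ex_number n (cycle_graph 8) + 7 * (t - 1) * n)"
proof -
  let ?C = "\<lambda>n. ex_number n (cycle_graph 8)" and ?W = "\<lambda>n. ex_number n (W_graph t)"
  \<comment> \<open>For n \<ge> 2, n \<le> 2(n - 1) is at most twice the extremal number of C_8,
    which turns \<open>7 * (t - 1) * n\<close> into the second summand.\<close>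
  let ?K = "2 ^ (14 * (t - 1) + 2) + 14 * (t - 1)"
  have lower: "?C n \<le> ?W n" for n
  proof (rule ex_number_le)
    have "{0, Suc 0 mod 8} \<in> edges (cycle_graph 8)"
      unfolding cycle_graph_def by (simp, intro exI[of _ 0]) simp
    then show "edges (cycle_graph 8) \<noteq> {}" by blast
  qed (use assms contains_cycle_if_contains_W_graph card_edges_le_ex_number in blast)
  have upper: "?W n \<le> 2 ^ (14 * (t - 1) + 2) * ?C n + 7 * (t - 1) * n" for n
  proof (rule ex_number_le)
    have "{glue (0, 0), glue (0, Suc 0 mod 8)} \<in> edges (W_graph t)"
      unfolding edges_W_graph using assms by (intro CollectI exI[of _ 0]) simp
    then show "edges (W_graph t) \<noteq> {}" by blast
  qed (use card_edges_W_graph_free in auto)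
  have linear: "?W n \<le> ?K * ?C n" if "n \<ge> 2" for n
  proof -
    have "n \<le> 2 * ?C n"
      using star_edges_le_ex_number_cycle[of n] that by linarith
    then have "7 * (t - 1) * n \<le> 7 * (t - 1) * (2 * ?C n)"
      by (rule mult_le_mono2)
    then show ?thesis
      using upper[of n] by (simp add: algebra_simps)
  qed
  have "(\<lambda>n. real (?W n)) \<in> O(\<lambda>n. real (?C n))"
  proof (rule bigoI)
    show "\<forall>\<^sub>F n in sequentially. norm (real (?W n)) \<le> real ?K * norm (real (?C n))"
      using eventually_ge_at_top[of 2]
    proof eventually_elim
      case (elim n)
      then have "real (?W n) \<le> real (?K * ?C n)"
        using linear by (simp only: of_nat_le_iff)
      then show ?case by simp
    qed
  qed
  moreover have "(\<lambda>n. real (?W n)) \<in> \<Omega>(\<lambda>n. real (?C n))"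
    using lower by (intro landau_omega.bigI[of 1]) auto
  ultimately show ?thesis
    using lower upper by (simp add: bigtheta_def)
qed

end
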